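(* Let $\mathcal{D}_i$ be a tractable $i$-uniform distribution on subsets of $\{0,1\}^n$ with density $f$. Then for every $M$ with $2<M\le 2^n$, $$\mathrm{Boost}(\mathcal{D}_i,M)\le 2^{i}\,B\!\left(\left\lceil n\,h^{-1}\!\left(\frac{\log_2 M-1}{n}\right)\right\rceil\right),$$ where $B(z)=\dfrac{\sum_{d=0}^{z-1}\binom{n}{d}f(d)}{\sum_{d=0}^{z-1}\binom{n}{d}}$, $h(x)=-x\log_2x-(1-x)\log_2(1-x)$ is the binary entropy function, and $h^{-1}:[0,1]\to[0,1]$ maps $y$ to the smallest $x$ with $h(x)=y$.
   Context: A distribution $\mathcal{D}_i$ on subsets of $\{0,1\}^n$ is $i$-uniform if, for $R\sim\mathcal{D}_i$, $\Pr[\sigma\in R]=2^{-i}$ for every $\sigma\in\{0,1\}^n$. It is tractable with density $f:\{0,\ldots,n\}\to[0,1]$ if for all $\sigma,\tau\in\{0,1\}^n$, $\Pr[\tau\in R\mid\sigma\in R]=f(\mathrm{Hamming}(\sigma,\tau))$, where $f(j)\ge f(j+1)$ for all $j<n/2$, and either $f(j)\ge f(j+1)$ for all $n/2\le j<n$, or $f(j)=f(n-j)$ for all $j\ge n/2$. For $M\ge1$, $$\mathrm{Boost}(\mathcal{D},M)=\max_{S\subseteq\{0,1\}^n,\ |S|\ge M}\ \frac{1}{|S|(|S|-1)}\sum_{\sigma,\tau\in S,\ \sigma\ne\tau}\frac{\Pr[\sigma,\tau\in R]}{\Pr[\sigma\in R]\Pr[\tau\in R]}.$$ *)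

theory Defs
  imports "HOL-Probability.Probability"
begin

definition cube :: "nat \<Rightarrow> bool list set" where
  "cube n = {\<sigma>. length \<sigma> = n}"

definition hamming :: "bool list \<Rightarrow> bool list \<Rightarrow> nat" where
  "hamming \<sigma> \<tau> = card {k. k < length \<sigma> \<and> \<sigma> ! k \<noteq> \<tau> ! k}"

(* Since the cube is finite, distributions on its subsets are exactly the pmfs
   supported on its power set. *)
definition distribution_on_subsets :: "nat \<Rightarrow> bool list set pmf \<Rightarrow> bool" where
  "distribution_on_subsets n D \<longleftrightarrow> set_pmf D \<subseteq> Pow (cube n)"

definition i_uniform :: "nat \<Rightarrow> nat \<Rightarrow> bool list set pmf \<Rightarrow> bool" where
  "i_uniform n i D \<longleftrightarrow>
     (\<forall>\<sigma>\<in>cube n. \<P>(R in measure_pmf D. \<sigma> \<in> R) = 1 / 2 ^ i)"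

(* Only the values of f on {0..n} matter. *)
definition tractable :: "nat \<Rightarrow> bool list set pmf \<Rightarrow> (nat \<Rightarrow> real) \<Rightarrow> bool" where
  "tractable n D f \<longleftrightarrow>
     (\<forall>j\<le>n. f j \<in> {0..1}) \<and>
     (\<forall>\<sigma>\<in>cube n. \<forall>\<tau>\<in>cube n.
        \<P>(R in measure_pmf D. \<tau> \<in> R \<bar> \<sigma> \<in> R) = f (hamming \<sigma> \<tau>)) \<and>
     (\<forall>j. real j < real n / 2 \<longrightarrow> f j \<ge> f (j + 1)) \<and>
     ((\<forall>j. real n / 2 \<le> real j \<and> j < n \<longrightarrow> f j \<ge> f (j + 1)) \<or>
      (\<forall>j. real n / 2 \<le> real j \<and> j \<le> n \<longrightarrow> f j = f (n - j)))"

(* The maximum is over a finite set, nonempty for M \<le> 2^n.  A singleton S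
   contributes 0 (as 0 / 0 = 0); this can only occur for M \<le> 1. *)
definition Boost :: "nat \<Rightarrow> bool list set pmf \<Rightarrow> real \<Rightarrow> real" where
  "Boost n D M =
     Max ((\<lambda>S. 1 / (real (card S) * (real (card S) - 1)) *
               (\<Sum>(\<sigma>, \<tau>) \<in> {(\<sigma>, \<tau>). \<sigma> \<in> S \<and> \<tau> \<in> S \<and> \<sigma> \<noteq> \<tau>}.
                  \<P>(R in measure_pmf D. \<sigma> \<in> R \<and> \<tau> \<in> R) /
                  (\<P>(R in measure_pmf D. \<sigma> \<in> R) * \<P>(R in measure_pmf D. \<tau> \<in> R))))
          ` {S. S \<subseteq> cube n \<and> real (card S) \<ge> M})"

definition ball_average :: "nat \<Rightarrow> (nat \<Rightarrow> real) \<Rightarrow> nat \<Rightarrow> real" where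
  "ball_average n f z =
     (\<Sum>d<z. real (n choose d) * f d) / (\<Sum>d<z. real (n choose d))"

(* The convention 0 * log 0 = 0 at the endpoints holds automatically. *)
definition binary_entropy :: "real \<Rightarrow> real" where
  "binary_entropy x = - x * log 2 x - (1 - x) * log 2 (1 - x)"

(* Meaningful for y in [0,1]. *)
definition inv_binary_entropy :: "real \<Rightarrow> real" where
  "inv_binary_entropy y = (LEAST x. x \<in> {0..1} \<and> binary_entropy x = y)"

end

theory Submission
  imports Defs "HOL-Real_Asymp.Real_Asymp"
begin

text \<open>
  Every normalised pair probability equals \<open>2^i * f(Hamming \<sigma> \<tau>)\<close>, so it suffices to bound, for each
  \<open>\<sigma> \<in> S\<close>, the average of \<open>f(Hamming \<sigma> \<tau>)\<close> over \<open>\<tau> \<in> S - {\<sigma>}\<close>. Under either alternative of tractability,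
  \<open>f j \<le> f (min j (n - j))\<close>, and \<open>f\<close> is nonincreasing up to \<open>n/2\<close>. At folded distance \<open>d\<close> from \<open>\<sigma>\<close> there
  are at most \<open>2 (n choose d)\<close> points, and for \<open>d = 0\<close> only one point other than \<open>\<sigma>\<close> itself. The entropy
  bound gives \<open>2 V \<le> M \<le> |S|\<close> for the size \<open>V\<close> of the Hamming ball of radius \<open>z - 1\<close>, so packing the
  points of \<open>S - {\<sigma>}\<close> as close to \<open>\<sigma>\<close> as possible cannot beat the ball average.
\<close>

section \<open>Hamming spheres in the cube\<close>

lemma finite_cube: "finite (cube n)"
  using finite_lists_length_eq[of "UNIV :: bool set" n] by (simp add: cube_def)

lemma card_cube: "card (cube n) = 2 ^ n"
  using card_lists_length_eq[of "UNIV :: bool set" n] by (simp add: cube_def)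

lemma hamming_le: "\<sigma> \<in> cube n \<Longrightarrow> hamming \<sigma> \<tau> \<le> n"
  unfolding hamming_def cube_def
  using card_mono[of "{..<n}" "{k. k < length \<sigma> \<and> \<sigma> ! k \<noteq> \<tau> ! k}"] by auto

text \<open>Entries are Boolean, so a point that differs from \<sigma> at a position must carry the
  negated bit there; the set of difference positions therefore determines the point.\<close>

lemma inj_on_difference_positions:
  assumes "\<sigma> \<in> cube n"
  shows "inj_on (\<lambda>\<tau>. {k. k < length \<sigma> \<and> \<sigma> ! k \<noteq> \<tau> ! k}) (cube n)"
proof (rule inj_onI)
  fix \<tau> \<rho> assume "\<tau> \<in> cube n" "\<rho> \<in> cube n"
    and eq: "{k. k < length \<sigma> \<and> \<sigma> ! k \<noteq> \<tau> ! k} = {k. k < length \<sigma> \<and> \<sigma> ! k \<noteq> \<rho> ! k}"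
  then show "\<tau> = \<rho>"
    using assms unfolding cube_def by (intro nth_equalityI) (auto simp: set_eq_iff)
qed

lemma card_hamming_sphere_le:
  assumes "\<sigma> \<in> cube n"
  shows "card {\<tau> \<in> cube n. hamming \<sigma> \<tau> = d} \<le> n choose d"
proof -
  let ?D = "\<lambda>\<tau>. {k. k < length \<sigma> \<and> \<sigma> ! k \<noteq> \<tau> ! k}"
  have "card {\<tau> \<in> cube n. hamming \<sigma> \<tau> = d} \<le> card {A. A \<subseteq> {..<n} \<and> card A = d}"
  proof (rule card_inj_on_le)
    show "inj_on ?D {\<tau> \<in> cube n. hamming \<sigma> \<tau> = d}"
      by (rule inj_on_subset[OF inj_on_difference_positions[OF assms]]) auto
    show "?D ` {\<tau> \<in> cube n. hamming \<sigma> \<tau> = d} \<subseteq> {A. A \<subseteq> {..<n} \<and> card A = d}"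
      using assms by (auto simp: hamming_def cube_def)
  qed auto
  then show ?thesis
    by (simp add: n_subsets)
qed

lemma hamming_eq_0_iff:
  assumes "\<sigma> \<in> cube n" "\<tau> \<in> cube n"
  shows "hamming \<sigma> \<tau> = 0 \<longleftrightarrow> \<tau> = \<sigma>"
  using assms unfolding hamming_def cube_def by (auto intro!: nth_equalityI)

text \<open>Folding identifies the distances d and n - d, whose spheres have the same binomial
  bound, hence the factor 2. The sharper bound at d = 0 supplies the saving of one point used in
  \<open>sum_le_ball_average\<close>.\<close>

lemma card_folded_sphere_le:
  assumes \<sigma>: "\<sigma> \<in> cube n" and T: "T \<subseteq> cube n - {\<sigma>}" and d: "d \<le> n"
  shows "card {\<tau> \<in> T. min (hamming \<sigma> \<tau>) (n - hamming \<sigma> \<tau>) = d}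
    \<le> (if d = 0 then 1 else 2 * (n choose d))"
proof -
  let ?S = "\<lambda>d. {\<tau> \<in> cube n. hamming \<sigma> \<tau> = d}"
  have fin: "finite (?S e)" for e using finite_cube by auto
  show ?thesis
  proof (cases "d = 0")
    case True
    \<comment> \<open>With \<sigma> excluded, folded distance 0 leaves only its antipode, at Hamming
      distance n.\<close>
    have "{\<tau> \<in> T. min (hamming \<sigma> \<tau>) (n - hamming \<sigma> \<tau>) = d} \<subseteq> ?S n"
    proof
      fix \<tau> assume "\<tau> \<in> {\<tau> \<in> T. min (hamming \<sigma> \<tau>) (n - hamming \<sigma> \<tau>) = d}"
      then have "\<tau> \<in> cube n" "\<tau> \<noteq> \<sigma>" "min (hamming \<sigma> \<tau>) (n - hamming \<sigma> \<tau>) = 0"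
        using T True by auto
      then show "\<tau> \<in> ?S n"
        using hamming_le[OF \<sigma>, of \<tau>] hamming_eq_0_iff[OF \<sigma>, of \<tau>] by (simp add: min_def split: if_splits)
    qed
    from card_mono[OF fin this] show ?thesis
      using True card_hamming_sphere_le[OF \<sigma>, of n] by simp
  next
    case False
    have "{\<tau> \<in> T. min (hamming \<sigma> \<tau>) (n - hamming \<sigma> \<tau>) = d} \<subseteq> ?S d \<union> ?S (n - d)"
    proof
      fix \<tau> assume "\<tau> \<in> {\<tau> \<in> T. min (hamming \<sigma> \<tau>) (n - hamming \<sigma> \<tau>) = d}"
      then have "\<tau> \<in> cube n" "min (hamming \<sigma> \<tau>) (n - hamming \<sigma> \<tau>) = d"
        using T by auto
      then show "\<tau> \<in> ?S d \<union> ?S (n - d)"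
        using hamming_le[OF \<sigma>, of \<tau>] by (auto simp: min_def split: if_splits)
    qed
    then have "card {\<tau> \<in> T. min (hamming \<sigma> \<tau>) (n - hamming \<sigma> \<tau>) = d} \<le> card (?S d \<union> ?S (n - d))"
      by (intro card_mono) (use fin in auto)
    also have "\<dots> \<le> card (?S d) + card (?S (n - d))"
      by (rule card_Un_le)
    also have "\<dots> \<le> (n choose d) + (n choose (n - d))"
      by (intro add_mono card_hamming_sphere_le \<sigma>)
    also have "\<dots> = 2 * (n choose d)"
      using binomial_symmetric[OF d] by simp
    finally show ?thesis using False by simp
  qed
qed

section \<open>Packing points around a centre\<close>

text \<open>Measure f relative to its boundary value c = f(z - 1): far points contribute nothing
  positive, and near points contribute at most 2X - e, where X is the total excess over one ball and
  e the excess at the centre. The ball average is c + X/V, so it remains to compare 2X - e with |T|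
  X/V.\<close>

lemma sum_le_ball_average:
  fixes f :: "nat \<Rightarrow> real" and \<delta> :: "'a \<Rightarrow> nat"
  assumes fin: "finite T" and z: "z > 0"
    and cnt: "\<And>d. d < z \<Longrightarrow> card {t \<in> T. \<delta> t = d} \<le> (if d = 0 then 1 else 2 * (n choose d))"
    and near: "\<And>d. d < z \<Longrightarrow> f (z - 1) \<le> f d"
    and far: "\<And>t. t \<in> T \<Longrightarrow> z \<le> \<delta> t \<Longrightarrow> f (\<delta> t) \<le> f (z - 1)"
    and zero: "\<And>d. d < z \<Longrightarrow> f d \<le> f 0"
    and big: "2 * (\<Sum>d<z. real (n choose d)) \<le> real (card T) + 1"
  shows "(\<Sum>t\<in>T. f (\<delta> t)) \<le> real (card T) * ball_average n f z"
proof -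
  define c where "c = f (z - 1)"
  define V where "V = (\<Sum>d<z. real (n choose d))"
  define X where "X = (\<Sum>d<z. real (n choose d) * (f d - c))"
  define e where "e = f 0 - c"
  have "1 = (\<Sum>d\<in>{0}. real (n choose d))" by simp
  also have "\<dots> \<le> V" unfolding V_def by (rule sum_mono2) (use z in auto)
  finally have V: "V \<ge> 1" .
  have X0: "X \<ge> 0" unfolding X_def by (intro sum_nonneg mult_nonneg_nonneg) (use near in \<open>auto simp: c_def\<close>)
  have XV: "X \<le> V * e"
    unfolding X_def V_def e_def sum_distrib_right
    by (intro sum_mono mult_left_mono) (auto simp: zero)
  have avg: "ball_average n f z = c + X / V"
    using V unfolding ball_average_def X_def V_def
    by (simp add: field_simps sum_subtractf sum_distrib_left)
  have "(\<Sum>t\<in>T. f (\<delta> t)) - real (card T) * c = (\<Sum>t\<in>T. f (\<delta> t) - c)"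
    by (simp add: sum_subtractf)
  also have "\<dots> \<le> (\<Sum>t\<in>T. if \<delta> t < z then f (\<delta> t) - c else 0)"
    by (rule sum_mono) (use far in \<open>auto simp: c_def not_less\<close>)
  also have "\<dots> = (\<Sum>t\<in>{t\<in>T. \<delta> t < z}. f (\<delta> t) - c)"
    using fin by (simp add: sum.inter_filter)
  also have "\<dots> = (\<Sum>d<z. \<Sum>t\<in>{t\<in>{t\<in>T. \<delta> t < z}. \<delta> t = d}. f (\<delta> t) - c)"
    by (rule sum.group[symmetric]) (use fin in auto)
  also have "\<dots> = (\<Sum>d<z. real (card {t \<in> T. \<delta> t = d}) * (f d - c))"
  proof (rule sum.cong[OF refl])
    fix d assume "d \<in> {..<z}"
    then have "{t\<in>{t\<in>T. \<delta> t < z}. \<delta> t = d} = {t \<in> T. \<delta> t = d}" by auto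
    then show "(\<Sum>t\<in>{t\<in>{t\<in>T. \<delta> t < z}. \<delta> t = d}. f (\<delta> t) - c)
        = real (card {t \<in> T. \<delta> t = d}) * (f d - c)" by simp
  qed
  \<comment> \<open>The count 1 at d = 0 is written as 2 * 1 - 1, so that all terms fit two full
    balls minus one centre.\<close>
  also have "\<dots> \<le> (\<Sum>d<z. (2 * real (n choose d) - (if d = 0 then 1 else 0)) * (f d - c))"
  proof (intro sum_mono mult_right_mono)
    fix d assume d: "d \<in> {..<z}"
    then have "real (card {t \<in> T. \<delta> t = d}) \<le> real (if d = 0 then 1 else 2 * (n choose d))"
      using cnt by (simp only: of_nat_le_iff lessThan_iff)
    then show "real (card {t \<in> T. \<delta> t = d}) \<le> 2 * real (n choose d) - (if d = 0 then 1 else 0)"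
      by (auto split: if_splits)
    show "0 \<le> f d - c" using near d by (simp add: c_def)
  qed
  also have "\<dots> = 2 * X - (\<Sum>d<z. if d = 0 then f d - c else 0)"
    unfolding X_def sum_distrib_left sum_subtractf[symmetric]
    by (rule sum.cong) (auto simp: algebra_simps)
  also have "(\<Sum>d<z. if d = 0 then f d - c else 0) = e"
    using z by (simp add: e_def)
  \<comment> \<open>X/V averages excesses that are each at most e, so the missing centre costs at
    least an average point.\<close>
  also have "2 * X - e \<le> 2 * X - X / V"
    using XV V by (simp add: field_simps)
  also have "\<dots> = (2 * V - 1) * X / V"
    using V by (simp add: field_simps)
  \<comment> \<open>Here \<open>big\<close> enters as 2V - 1 \<le> |T|, with X \<ge> 0.\<close>
  also have "\<dots> \<le> real (card T) * X / V"
    using big X0 V by (intro divide_right_mono mult_right_mono) (auto simp: V_def)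
  finally show ?thesis by (simp add: avg algebra_simps)
qed

section \<open>Binary entropy and the volume of Hamming balls\<close>

lemma continuous_on_binary_entropy: "continuous_on {0..1/2} binary_entropy"
proof -
  have "continuous (at x within {0..1/2}) binary_entropy" if x: "x \<in> {0..1/2}" for x
  proof (cases "x = 0")
    case True
    \<comment> \<open>At 0 the logarithm is discontinuous, so continuity comes from the limit of x
      log x.\<close>
    have "(binary_entropy \<longlongrightarrow> 0) (at_right 0)"
      unfolding binary_entropy_def by real_asymp
    moreover have "at 0 within {0..1/2::real} = at_right 0"
      by (simp add: at_within_Icc_at_right)
    ultimately show ?thesis
      using True by (simp add: continuous_within binary_entropy_def)
  next
    case False
    with x have "isCont binary_entropy x"
      unfolding binary_entropy_def by (intro continuous_intros) auto
    then show ?thesis by (rule continuous_at_imp_continuous_at_within)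
  qed
  then show ?thesis by (simp add: continuous_on_eq_continuous_within)
qed

text \<open>\<open>LEAST\<close> over the reals yields a solution only if a smallest one exists. The
  solutions in [0, 1/2] form a nonempty compact set, by the intermediate value theorem and
  continuity, so their infimum is attained; any solution above 1/2 is larger anyway.\<close>

lemma inv_binary_entropy:
  assumes "0 < y" "y \<le> 1"
  shows "binary_entropy (inv_binary_entropy y) = y"
    and "0 < inv_binary_entropy y" and "inv_binary_entropy y \<le> 1/2"
proof -
  let ?A = "{x \<in> {0..1/2}. binary_entropy x = y}"
  have h0: "binary_entropy 0 = 0" by (simp add: binary_entropy_def)
  have h1: "binary_entropy (1/2) = 1" by (simp add: binary_entropy_def log_divide)
  have "\<exists>x\<ge>0. x \<le> 1/2 \<and> binary_entropy x = y"
    by (rule IVT'[of binary_entropy 0 y "1/2"]) (use assms h0 h1 continuous_on_binary_entropy in auto)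
  then have ne: "?A \<noteq> {}" by auto
  have "closed ?A"
    using continuous_closed_preimage_constant[OF continuous_on_binary_entropy, of y] by simp
  moreover have "bounded ?A"
    by (rule bounded_subset[of "{0..1/2}"]) auto
  ultimately have "compact ?A"
    by (simp add: compact_eq_bounded_closed)
  from compact_attains_inf[OF this ne] obtain p where p: "p \<in> ?A" "\<And>x. x \<in> ?A \<Longrightarrow> p \<le> x"
    by blast
  have "inv_binary_entropy y = p"
    unfolding inv_binary_entropy_def
  proof (rule Least_equality)
    show "p \<in> {0..1} \<and> binary_entropy p = y" using p(1) by auto
    fix x assume x: "x \<in> {0..1} \<and> binary_entropy x = y"
    show "p \<le> x"
      using p x by (cases "x \<le> 1/2") auto
  qed
  moreover have "p \<noteq> 0" using p(1) h0 assms by auto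
  ultimately show "binary_entropy (inv_binary_entropy y) = y" "0 < inv_binary_entropy y"
    "inv_binary_entropy y \<le> 1/2"
    using p(1) by auto
qed

text \<open>In the binomial expansion of (p + (1 - p))^n = 1, every weight p^d (1 - p)^(n - d) with
  d \<le> np is at least 2^(-n h(p)); summing over the ball gives the bound.\<close>

lemma hamming_ball_volume_le:
  fixes p :: real
  assumes p: "0 < p" "p \<le> 1/2" and z: "\<And>d. d < z \<Longrightarrow> real d \<le> real n * p"
  shows "(\<Sum>d<z. real (n choose d)) \<le> 2 powr (real n * binary_entropy p)"
proof -
  let ?q = "2 powr (- (real n * binary_entropy p))"
  have dn: "d \<le> n" if "d < z" for d
  proof -
    have "real n * p \<le> real n * 1" using p by (intro mult_left_mono) auto
    with z[OF that] show ?thesis by simp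
  qed
  have q: "?q = p powr (real n * p) * (1 - p) powr (real n - real n * p)"
    using p by (simp add: powr_def binary_entropy_def log_def exp_add[symmetric] field_simps)
  have summand: "?q \<le> p ^ d * (1 - p) ^ (n - d)" if d: "d < z" for d
  proof -
    have "?q = p powr real d * (p powr (real n * p - real d) * (1 - p) powr (real n - real n * p))"
      using p by (simp add: q powr_add[symmetric] flip: mult.assoc)
    \<comment> \<open>Since p \<le> 1 - p and np - d \<ge> 0, the surplus factors p may be replaced
      by factors 1 - p.\<close>
    also have "\<dots> \<le> p powr real d * ((1 - p) powr (real n * p - real d) * (1 - p) powr (real n - real n * p))"
      using p z[OF d] by (intro mult_left_mono mult_right_mono powr_mono2) auto
    also have "\<dots> = p powr real d * (1 - p) powr real (n - d)"
      using p dn[OF d] by (simp add: powr_add[symmetric] of_nat_diff)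
    also have "\<dots> = p ^ d * (1 - p) ^ (n - d)"
      using p by (simp add: powr_realpow)
    finally show ?thesis .
  qed
  have "(\<Sum>d<z. real (n choose d)) * ?q \<le> (\<Sum>d<z. real (n choose d) * p ^ d * (1 - p) ^ (n - d))"
    unfolding sum_distrib_right mult.assoc by (intro sum_mono mult_left_mono summand) auto
  also have "\<dots> \<le> (\<Sum>d\<le>n. real (n choose d) * p ^ d * (1 - p) ^ (n - d))"
    using p dn by (intro sum_mono2) auto
  also have "\<dots> = (p + (1 - p)) ^ n"
    by (rule binomial_ring[symmetric])
  finally show ?thesis
    by (simp add: powr_minus field_simps)
qed

section \<open>Consequences of tractability and uniformity\<close>

lemma tractable_antimono:
  assumes "tractable n D f" and "a \<le> b" and "2 * b \<le> n"
  shows "f b \<le> f a"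
  using assms(2,3)
proof (induction b rule: dec_induct)
  case (step b)
  then have "real b < real n / 2" by simp
  then have "f (b + 1) \<le> f b" using assms(1) by (auto simp: tractable_def)
  with step show ?case by simp
qed simp

text \<open>Only j > n/2 matters. There the first alternative makes f nonincreasing on all of {0..n}
  while n - j < j, and the second gives equality.\<close>

lemma tractable_le_folded:
  assumes tr: "tractable n D f" and j: "j \<le> n"
  shows "f j \<le> f (min j (n - j))"
proof (cases "2 * j \<le> n")
  case True
  then have "min j (n - j) = j" by simp
  then show ?thesis by simp
next
  case False
  consider (mono) "\<forall>j. real n / 2 \<le> real j \<and> j < n \<longrightarrow> f j \<ge> f (j + 1)"
    | (sym) "\<forall>j. real n / 2 \<le> real j \<and> j \<le> n \<longrightarrow> f j = f (n - j)"
    using tr by (auto simp: tractable_def)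
  then show ?thesis
  proof cases
    case mono
    have decr: "f (k + 1) \<le> f k" if "k < n" for k
      using mono tr that by (cases "real n / 2 \<le> real k") (auto simp: tractable_def)
    have "f b \<le> f a" if "a \<le> b" "b \<le> n" for a b
      using that
    proof (induction b rule: dec_induct)
      case (step b)
      then show ?case using decr[of b] by simp
    qed simp
    then show ?thesis using j by simp
  next
    case sym
    then have "f j = f (n - j)" using False j by auto
    then show ?thesis using False by (simp add: min_def)
  qed
qed

text \<open>Conditioning on \<sigma> already divides by one marginal; the other marginal leaves the
  factor 2^i.\<close>

lemma normalised_pair_probability:
  assumes "i_uniform n i D" and "tractable n D f" and "\<sigma> \<in> cube n" and "\<tau> \<in> cube n"
  shows "\<P>(R in measure_pmf D. \<sigma> \<in> R \<and> \<tau> \<in> R) /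
      (\<P>(R in measure_pmf D. \<sigma> \<in> R) * \<P>(R in measure_pmf D. \<tau> \<in> R))
    = 2 ^ i * f (hamming \<sigma> \<tau>)"
proof -
  have u: "\<P>(R in measure_pmf D. \<sigma> \<in> R) = 1 / 2 ^ i" "\<P>(R in measure_pmf D. \<tau> \<in> R) = 1 / 2 ^ i"
    using assms by (auto simp: i_uniform_def)
  have "\<P>(R in measure_pmf D. \<tau> \<in> R \<bar> \<sigma> \<in> R) = f (hamming \<sigma> \<tau>)"
    using assms by (auto simp: tractable_def)
  then have "\<P>(R in measure_pmf D. \<sigma> \<in> R \<and> \<tau> \<in> R) * 2 ^ i = f (hamming \<sigma> \<tau>)"
    using u by (simp add: cond_prob_def conj_commute)
  then show ?thesis unfolding u by (simp add: field_simps)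
qed

theorem theorem5:
  fixes n i :: nat and D :: "bool list set pmf" and f :: "nat \<Rightarrow> real" and M :: real
  assumes "distribution_on_subsets n D"
    and "i_uniform n i D"
    and "tractable n D f"
    and "2 < M" and "M \<le> 2 ^ n"
  shows "Boost n D M
    \<le> 2 ^ i * ball_average n f
        (nat \<lceil>real n * inv_binary_entropy ((log 2 M - 1) / real n)\<rceil>)"
proof -
  define y where "y = (log 2 M - 1) / real n"
  define p where "p = inv_binary_entropy y"
  define z where "z = nat \<lceil>real n * p\<rceil>"
  have n: "n > 0" using assms(4,5) by (cases n) auto
  have "log 2 2 < log 2 M" using assms(4) by (intro log_less) auto
  then have lo: "1 < log 2 M" by simp
  have "log 2 M \<le> log 2 (2 ^ n)" using assms(4,5) by (intro log_mono) auto
  then have hi: "log 2 M \<le> real n" by simp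
  have y: "0 < y" "y \<le> 1" using lo hi n by (auto simp: y_def field_simps)
  note p = inv_binary_entropy[OF y, folded p_def]
  have z0: "z > 0" using n p(2) by (simp add: z_def)
  \<comment> \<open>Rounding up is harmless: the ball sums stop at z - 1, which is still below
    np.\<close>
  have dz: "real d < real n * p" if "d < z" for d
    using that unfolding z_def by linarith
  \<comment> \<open>The ball stays in the half where f is nonincreasing.\<close>
  have dz2: "2 * d \<le> n" if "d < z" for d
  proof -
    have "real n * p \<le> real n * (1/2)" using p(3) by (intro mult_left_mono) auto
    with dz[OF that] show ?thesis by simp
  qed
  have "(\<Sum>d<z. real (n choose d)) \<le> 2 powr (real n * y)"
    using hamming_ball_volume_le[of p z n] p dz by (auto simp: less_imp_le)
  \<comment> \<open>The -1 in the argument of the inverse entropy halves M and so pays for the two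
    balls created by folding.\<close>
  also have "\<dots> = M / 2"
    using n assms(4) by (simp add: y_def powr_diff)
  finally have vol: "2 * (\<Sum>d<z. real (n choose d)) \<le> M" by simp

  have row: "(\<Sum>\<tau>\<in>S - {\<sigma>}. f (hamming \<sigma> \<tau>)) \<le> (real (card S) - 1) * ball_average n f z"
    if S: "S \<subseteq> cube n" "M \<le> real (card S)" and \<sigma>: "\<sigma> \<in> S" for S \<sigma>
  proof -
    let ?\<delta> = "\<lambda>\<tau>. min (hamming \<sigma> \<tau>) (n - hamming \<sigma> \<tau>)"
    have finS: "finite S" using S finite_cube finite_subset by blast
    then have "card S > 0" using \<sigma> by (auto simp: card_gt_0_iff)
    then have cardT: "real (card (S - {\<sigma>})) = real (card S) - 1"
      using \<sigma> by (simp add: of_nat_diff)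
    have \<sigma>c: "\<sigma> \<in> cube n" using S \<sigma> by auto
    have "(\<Sum>\<tau>\<in>S - {\<sigma>}. f (hamming \<sigma> \<tau>)) \<le> (\<Sum>\<tau>\<in>S - {\<sigma>}. f (?\<delta> \<tau>))"
      by (intro sum_mono tractable_le_folded[OF assms(3)] hamming_le \<sigma>c)
    also have "\<dots> \<le> real (card (S - {\<sigma>})) * ball_average n f z"
    proof (rule sum_le_ball_average)
      show "card {t \<in> S - {\<sigma>}. ?\<delta> t = d} \<le> (if d = 0 then 1 else 2 * (n choose d))" if "d < z" for d
        using dz2[OF that] S(1) by (intro card_folded_sphere_le \<sigma>c) auto
      show "f (z - 1) \<le> f d" if "d < z" for d
        using that z0 dz2[of "z - 1"] by (intro tractable_antimono[OF assms(3)]) auto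
      show "f d \<le> f 0" if "d < z" for d
        using dz2[OF that] by (intro tractable_antimono[OF assms(3)]) auto
      \<comment> \<open>A folded distance never exceeds n/2, so monotonicity applies beyond the ball
        as well.\<close>
      show "f (?\<delta> t) \<le> f (z - 1)" if "z \<le> ?\<delta> t" for t
        using that by (intro tractable_antimono[OF assms(3)]) auto
      show "2 * (\<Sum>d<z. real (n choose d)) \<le> real (card (S - {\<sigma>})) + 1"
        using vol S(2) cardT by simp
    qed (use finS z0 in auto)
    finally show ?thesis by (simp only: cardT)
  qed

  have bound: "1 / (real (card S) * (real (card S) - 1)) *
      (\<Sum>(\<sigma>, \<tau>) \<in> {(\<sigma>, \<tau>). \<sigma> \<in> S \<and> \<tau> \<in> S \<and> \<sigma> \<noteq> \<tau>}.
         \<P>(R in measure_pmf D. \<sigma> \<in> R \<and> \<tau> \<in> R) /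
         (\<P>(R in measure_pmf D. \<sigma> \<in> R) * \<P>(R in measure_pmf D. \<tau> \<in> R)))
      \<le> 2 ^ i * ball_average n f z" (is "?c * ?s \<le> _")
    if S: "S \<subseteq> cube n" "M \<le> real (card S)" for S
  proof -
    have finS: "finite S" using S finite_cube finite_subset by blast
    have pairs: "{(\<sigma>, \<tau>). \<sigma> \<in> S \<and> \<tau> \<in> S \<and> \<sigma> \<noteq> \<tau>} = (SIGMA \<sigma>:S. S - {\<sigma>})" by auto
    have "?s = (\<Sum>\<sigma>\<in>S. \<Sum>\<tau>\<in>S - {\<sigma>}. \<P>(R in measure_pmf D. \<sigma> \<in> R \<and> \<tau> \<in> R) /
         (\<P>(R in measure_pmf D. \<sigma> \<in> R) * \<P>(R in measure_pmf D. \<tau> \<in> R)))"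
      unfolding pairs by (rule sum.Sigma[symmetric]) (use finS in auto)
    also have "\<dots> = (\<Sum>\<sigma>\<in>S. \<Sum>\<tau>\<in>S - {\<sigma>}. 2 ^ i * f (hamming \<sigma> \<tau>))"
      by (intro sum.cong refl normalised_pair_probability[OF assms(2,3)]) (use S in auto)
    also have "\<dots> = 2 ^ i * (\<Sum>\<sigma>\<in>S. \<Sum>\<tau>\<in>S - {\<sigma>}. f (hamming \<sigma> \<tau>))"
      by (simp add: sum_distrib_left)
    also have "\<dots> \<le> 2 ^ i * (\<Sum>\<sigma>\<in>S. (real (card S) - 1) * ball_average n f z)"
      by (intro mult_left_mono sum_mono row[OF S]) auto
    finally have "?s \<le> real (card S) * (real (card S) - 1) * (2 ^ i * ball_average n f z)"
      by (simp add: mult_ac)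
    \<comment> \<open>M > 2 rules out the degenerate division by zero.\<close>
    moreover have "real (card S) * (real (card S) - 1) > 0"
      using S(2) assms(4) by (intro mult_pos_pos) auto
    ultimately show ?thesis
      by (simp add: field_simps)
  qed

  \<comment> \<open>The full cube witnesses that the maximum ranges over a nonempty set.\<close>
  have "cube n \<in> {S. S \<subseteq> cube n \<and> M \<le> real (card S)}"
    using assms(5) by (simp add: card_cube)
  moreover have "finite {S. S \<subseteq> cube n \<and> M \<le> real (card S)}"
    by (rule finite_subset[of _ "Pow (cube n)"]) (auto simp: finite_cube)
  ultimately have "Boost n D M \<le> 2 ^ i * ball_average n f z"
    unfolding Boost_def using bound by (subst Max_le_iff) auto
  then show ?thesis by (simp only: z_def p_def y_def)
qed

end
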